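(* Fix a mechanism $\mathcal M=(X,P)$, an instance $I$, a bidder $i$, a threshold function $T_i:\mathcal X_i\times\mathcal A_{-i}\to\mathbb R_{\ge0}$, an optimal liquid welfare profile $\chi^*$, and $\lambda>0$, $\mu\ge0$. If bidder $i$ is conservatively $(\lambda,\mu)$-semi-smooth, then bidder $i$ is budget-feasible $(\lambda,\mu)$-semi-smooth.
   Context: An instance $I$ consists of bidders $N=[n]$, $n\ge2$, where bidder $i$ has an action set $\mathcal A_i$, a finite set of allocations $\mathcal X_i$, a valuation $v_i:\mathcal X_i\to\mathbb R_{\ge0}$ and a budget $B_i\in(0,\infty]$; $\mathcal A=\prod_i\mathcal A_i$, and $\mathcal X\subseteq\prod_i\mathcal X_i$ is the set of feasible allocation profiles. A mechanism $\mathcal M=(X,P)$ consists of $X:\mathcal A\to\mathcal X$ and $P:\mathcal A\to\mathbb R_{\ge0}^n$. Each bidder has an opt-out action $\emptyset_i\in\mathcal A_i$ with $P_i(\emptyset_i,a_{-i})=0$ for all $a_{-i}$. Utility: $u_i(a)=v_i(X_i(a))-P_i(a)$. $\Delta(S)$ is the set of probability distributions on $S$. For $A\in\Delta(\mathcal A)$, $A_{-i}$ is the marginal on the other bidders' actions. $\mathcal C_i(A_{-i})$ is the set of $A_i'\in\Delta(\mathcal A_i)$ with $\mathbb E_{a_i'\sim A_i',\,a_{-i}\sim A_{-i}}[P_i(a_i',a_{-i})]\le B_i$ (independent draws). A distribution $A\in\Delta(\mathcal A)$ with $\mathbb E_{a\sim A}[P_i(a)]\le B_i$ for all $i$ is a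 coarse correlated equilibrium, $A\in\mathrm{CCE}(I)$, if for all $i$ and all $A_i'\in\mathcal C_i(A_{-i})$: $\mathbb E_{a\sim A}[u_i(a)]\ge\mathbb E_{a_i'\sim A_i',a_{-i}\sim A_{-i}}[u_i(a_i',a_{-i})]$. (If the analysis is restricted to a subset of equilibria, such as those satisfying a no-overbidding condition, $\mathrm{CCE}(I)$ is replaced by that subset in both smoothness notions below.) For $\chi\in\Delta(\mathcal X)$ with marginals $\chi_i$, $\hat v_i(\chi_i)=\min\{\mathbb E_{x_i\sim\chi_i}[v_i(x_i)],B_i\}$; an optimal liquid welfare profile $\chi^*$ is a maximizer of $\sum_i\hat v_i(\chi_i)$ over $\Delta(\mathcal X)$. Bidder $i$ is conservatively $(\lambda,\mu)$-semi-smooth if for every $A\in\mathrm{CCE}(I)$ and every $x_i\in\mathcal X_i$ there is $A_i'\in\Delta(\mathcal A_i)$ (drawn independently of the realization of $A$) such that $$\mathbb E_{a_i'\sim A_i',a_{-i}\sim A_{-i}}[u_i(a_i',a_{-i})]\ge\lambda v_i(x_i)-\mu\,\mathbb E_{a_{-i}\sim A_{-i}}[T_i(x_i,a_{-i})]$$ and $\mathbb E_{a_i'\sim A_i',a_{-i}\sim A_{-i}}[P_i(a_i',a_{-i})]\le v_i(x_i)$. Bidder $i$ is budget-feasible $(\lambda,\mu)$-semi-smooth if for every $A\in\mathrm{CCE}(I)$ there is $A_i'\in\mathcal C_i(A_{-i})$ with $$\mathbb E_{a_i'\sim A_i',a_{-i}\sim A_{-i}}[u_i(a_i',a_{-i})]\ge\lambda\hat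 v_i(\chi_i^* )-\mu\,\mathbb E_{x_i\sim\chi_i^*,a_{-i}\sim A_{-i}}[T_i(x_i,a_{-i})].$$ *)

theory Defs
  imports "HOL-Probability.Probability"
begin

text \<open>
  Expectation of a real random variable with values in the extended reals. It avoids the
  Bochner convention that non-integrable functions have integral zero: unbounded payments and
  thresholds get their true, possibly infinite, expectation. All variables below are bounded
  above or bounded below, so the meaningless case of infinity minus infinity never arises.
\<close>
definition expect :: "'b measure \<Rightarrow> ('b \<Rightarrow> real) \<Rightarrow> ereal" where
  "expect M f = enn2ereal (\<integral>\<^sup>+ x. ennreal (f x) \<partial>M) - enn2ereal (\<integral>\<^sup>+ x. ennreal (- f x) \<partial>M)"

abbreviation dists :: "'b measure \<Rightarrow> 'b measure set" where
  "dists M \<equiv> space (prob_algebra M)"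

text \<open>
  The action set of bidder \<open>i\<close> is the underlying set of the measurable space \<open>actions I i\<close>, so
  arbitrary (for instance continuous) distributions of actions are covered. Action and
  allocation sets of different bidders are different subsets of a common type.
\<close>
record ('a, 'x) auction_instance =
  num_bidders :: nat
  actions :: "nat \<Rightarrow> 'a measure"
  allocs :: "nat \<Rightarrow> 'x set"
  feasible :: "(nat \<Rightarrow> 'x) set"
  valuation :: "nat \<Rightarrow> 'x \<Rightarrow> real"
  budget :: "nat \<Rightarrow> ereal"

record ('a, 'x) mechanism =
  mech_alloc :: "(nat \<Rightarrow> 'a) \<Rightarrow> (nat \<Rightarrow> 'x)"
  payment :: "(nat \<Rightarrow> 'a) \<Rightarrow> (nat \<Rightarrow> real)"

definition bidders :: "('a, 'x) auction_instance \<Rightarrow> nat set" where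
  "bidders I = {1..num_bidders I}"

definition profiles :: "('a, 'x) auction_instance \<Rightarrow> (nat \<Rightarrow> 'a) measure" where
  "profiles I = (\<Pi>\<^sub>M i\<in>bidders I. actions I i)"

definition others :: "('a, 'x) auction_instance \<Rightarrow> nat \<Rightarrow> (nat \<Rightarrow> 'a) measure" where
  "others I i = (\<Pi>\<^sub>M j\<in>bidders I - {i}. actions I j)"

definition wf_instance :: "('a, 'x) auction_instance \<Rightarrow> bool" where
  "wf_instance I \<longleftrightarrow>
     num_bidders I \<ge> 2 \<and>
     (\<forall>i\<in>bidders I. finite (allocs I i)) \<and>
     feasible I \<subseteq> (\<Pi>\<^sub>E i\<in>bidders I. allocs I i) \<and>
     (\<forall>i\<in>bidders I. \<forall>x\<in>allocs I i. valuation I i x \<ge> 0) \<and>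
     (\<forall>i\<in>bidders I. budget I i > 0)"

text \<open>
  Measurability of the allocation and payment rules is what makes the expectations meaningful.
  The last conjunct is the existence of an opt-out action.
\<close>
definition wf_mechanism :: "('a, 'x) auction_instance \<Rightarrow> ('a, 'x) mechanism \<Rightarrow> bool" where
  "wf_mechanism I M \<longleftrightarrow>
     mech_alloc M \<in> space (profiles I) \<rightarrow> feasible I \<and>
     (\<forall>i\<in>bidders I. (\<lambda>a. mech_alloc M a i) \<in> profiles I \<rightarrow>\<^sub>M count_space (allocs I i)) \<and>
     (\<forall>a\<in>space (profiles I). \<forall>i\<in>bidders I. payment M a i \<ge> 0) \<and>
     (\<forall>i\<in>bidders I. (\<lambda>a. payment M a i) \<in> borel_measurable (profiles I)) \<and>
     (\<forall>i\<in>bidders I. \<exists>d\<in>space (actions I i). \<forall>a\<in>space (others I i). payment M (a(i := d)) i = 0)"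

definition utility ::
  "('a, 'x) auction_instance \<Rightarrow> ('a, 'x) mechanism \<Rightarrow> nat \<Rightarrow> (nat \<Rightarrow> 'a) \<Rightarrow> real" where
  "utility I M i a = valuation I i (mech_alloc M a i) - payment M a i"

definition marginal_others ::
  "('a, 'x) auction_instance \<Rightarrow> nat \<Rightarrow> (nat \<Rightarrow> 'a) measure \<Rightarrow> (nat \<Rightarrow> 'a) measure" where
  "marginal_others I i A = distr A (others I i) (\<lambda>a. restrict a (bidders I - {i}))"

text \<open>Bidder \<open>i\<close> draws from \<open>D\<close>, independently of the others, who draw jointly from \<open>R\<close>.\<close>
definition dev_utility ::
  "('a, 'x) auction_instance \<Rightarrow> ('a, 'x) mechanism \<Rightarrow> nat \<Rightarrow> 'a measure \<Rightarrow> (nat \<Rightarrow> 'a) measure \<Rightarrow> ereal"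
  where
  "dev_utility I M i D R = expect (D \<Otimes>\<^sub>M R) (\<lambda>(d, a). utility I M i (a(i := d)))"

definition dev_payment ::
  "('a, 'x) mechanism \<Rightarrow> nat \<Rightarrow> 'a measure \<Rightarrow> (nat \<Rightarrow> 'a) measure \<Rightarrow> ereal" where
  "dev_payment M i D R = expect (D \<Otimes>\<^sub>M R) (\<lambda>(d, a). payment M (a(i := d)) i)"

definition feasible_devs ::
  "('a, 'x) auction_instance \<Rightarrow> ('a, 'x) mechanism \<Rightarrow> nat \<Rightarrow> (nat \<Rightarrow> 'a) measure \<Rightarrow> 'a measure set"
  where
  "feasible_devs I M i R = {D \<in> dists (actions I i). dev_payment M i D R \<le> budget I i}"

definition CCE ::
  "('a, 'x) auction_instance \<Rightarrow> ('a, 'x) mechanism \<Rightarrow> (nat \<Rightarrow> 'a) measure set" where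
  "CCE I M =
     {A \<in> dists (profiles I).
        (\<forall>i\<in>bidders I. expect A (\<lambda>a. payment M a i) \<le> budget I i) \<and>
        (\<forall>i\<in>bidders I. \<forall>D\<in>feasible_devs I M i (marginal_others I i A).
           expect A (utility I M i) \<ge> dev_utility I M i D (marginal_others I i A))}"

definition alloc_dists :: "('a, 'x) auction_instance \<Rightarrow> (nat \<Rightarrow> 'x) pmf set" where
  "alloc_dists I = {Q. set_pmf Q \<subseteq> feasible I}"

definition alloc_marginal :: "nat \<Rightarrow> (nat \<Rightarrow> 'x) pmf \<Rightarrow> 'x pmf" where
  "alloc_marginal i Q = map_pmf (\<lambda>x. x i) Q"

definition liquid_value :: "('a, 'x) auction_instance \<Rightarrow> nat \<Rightarrow> 'x pmf \<Rightarrow> ereal" where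
  "liquid_value I i p = min (expect (measure_pmf p) (valuation I i)) (budget I i)"

definition liquid_welfare :: "('a, 'x) auction_instance \<Rightarrow> (nat \<Rightarrow> 'x) pmf \<Rightarrow> ereal" where
  "liquid_welfare I Q = (\<Sum>i\<in>bidders I. liquid_value I i (alloc_marginal i Q))"

definition optimal_liquid_profile ::
  "('a, 'x) auction_instance \<Rightarrow> (nat \<Rightarrow> 'x) pmf \<Rightarrow> bool" where
  "optimal_liquid_profile I Q \<longleftrightarrow>
     Q \<in> alloc_dists I \<and> (\<forall>Q'\<in>alloc_dists I. liquid_welfare I Q' \<le> liquid_welfare I Q)"

definition threshold_function ::
  "('a, 'x) auction_instance \<Rightarrow> nat \<Rightarrow> ('x \<Rightarrow> (nat \<Rightarrow> 'a) \<Rightarrow> real) \<Rightarrow> bool" where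
  "threshold_function I i T \<longleftrightarrow>
     (\<forall>x\<in>allocs I i. T x \<in> borel_measurable (others I i) \<and> (\<forall>a\<in>space (others I i). T x a \<ge> 0))"

text \<open>
  In both notions of smoothness \<open>E\<close> is the set of equilibria under consideration: all of
  \<open>CCE I M\<close>, or a subset of it to which the analysis is restricted. If a threshold has infinite
  expectation, then the right-hand side is minus infinity when \<open>mu > 0\<close>; when \<open>mu = 0\<close> the
  threshold term vanishes, by the convention \<open>0 * \<infinity> = 0\<close> of the extended reals.
\<close>
definition conservatively_semi_smooth ::
  "('a, 'x) auction_instance \<Rightarrow> ('a, 'x) mechanism \<Rightarrow> (nat \<Rightarrow> 'a) measure set \<Rightarrow> nat \<Rightarrow>
    ('x \<Rightarrow> (nat \<Rightarrow> 'a) \<Rightarrow> real) \<Rightarrow> real \<Rightarrow> real \<Rightarrow> bool" where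
  "conservatively_semi_smooth I M E i T lam mu \<longleftrightarrow>
     (\<forall>A\<in>E. \<forall>x\<in>allocs I i. \<exists>D\<in>dists (actions I i).
        dev_utility I M i D (marginal_others I i A)
          \<ge> ereal lam * ereal (valuation I i x) - ereal mu * expect (marginal_others I i A) (T x) \<and>
        dev_payment M i D (marginal_others I i A) \<le> ereal (valuation I i x))"

definition budget_feasible_semi_smooth ::
  "('a, 'x) auction_instance \<Rightarrow> ('a, 'x) mechanism \<Rightarrow> (nat \<Rightarrow> 'a) measure set \<Rightarrow> nat \<Rightarrow>
    ('x \<Rightarrow> (nat \<Rightarrow> 'a) \<Rightarrow> real) \<Rightarrow> (nat \<Rightarrow> 'x) pmf \<Rightarrow> real \<Rightarrow> real \<Rightarrow> bool" where
  "budget_feasible_semi_smooth I M E i T Q lam mu \<longleftrightarrow>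
     (\<forall>A\<in>E. \<exists>D\<in>feasible_devs I M i (marginal_others I i A).
        dev_utility I M i D (marginal_others I i A)
          \<ge> ereal lam * liquid_value I i (alloc_marginal i Q)
             - ereal mu * expect (measure_pmf (alloc_marginal i Q) \<Otimes>\<^sub>M marginal_others I i A)
                 (\<lambda>(x, a). T x a))"

end

theory Submission
  imports Defs
begin

text \<open>
  Let \<open>D\<close> first draw \<open>x\<close> from bidder \<open>i\<close>'s marginal of the optimal profile and then play the
  conservative deviation for \<open>x\<close>. Averaging the conservative guarantees bounds the expected
  payment of \<open>D\<close> by the expected value \<open>V\<close> of the marginal and its expected utility from below by
  \<open>lam * V\<close> minus the threshold term. If \<open>V\<close> exceeds the budget \<open>B\<close>, play \<open>D\<close> with probability
  \<open>B / V\<close> and opt out otherwise: this scales payment and guarantee by \<open>B / V\<close>, while opting out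
  has nonnegative utility and the threshold term is only reduced.
\<close>

section \<open>Extended-valued expectations and ordinary integrals\<close>

lemma expect_nonneg:
  assumes "AE x in M. 0 \<le> f x"
  shows "expect M f = enn2ereal (\<integral>\<^sup>+ x. ennreal (f x) \<partial>M)"
proof -
  have "(\<integral>\<^sup>+ x. ennreal (- f x) \<partial>M) = (\<integral>\<^sup>+ x. 0 \<partial>M)"
    by (rule nn_integral_cong_AE) (use assms in \<open>auto simp: ennreal_neg\<close>)
  then show ?thesis
    by (simp add: expect_def zero_ennreal.rep_eq)
qed

lemma expect_eq_integral:
  assumes "integrable M f"
  shows "expect M f = ereal (integral\<^sup>L M f)"
proof -
  have "enn2ereal e = ereal (enn2real e)" if "e \<noteq> \<infinity>" for e
    using that by (cases e) (auto simp: top_ennreal.rep_eq)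
  then show ?thesis
    using assms by (simp add: expect_def real_lebesgue_integral_def real_integrable_def)
qed

text \<open>Serves to turn a finite bound on an expected payment into integrability, after which the
  Bochner integral gives the true expectation.\<close>

lemma integrable_of_expect:
  assumes "f \<in> borel_measurable M" "AE x in M. 0 \<le> f x" "expect M f < \<infinity>"
  shows "integrable M f"
  using assms(3)
  by (intro integrableI_nonneg assms(1,2))
    (simp add: expect_nonneg[OF assms(2)] less_top[symmetric] top_ennreal.rep_eq enn2ereal_eq_top_iff)

section \<open>Integrals over an independent pair whose first draw is mixed or deterministic\<close>

text \<open>Fubini pulls the integral over \<open>R\<close> inside, so that only the first draw is
  left. Integrating against a \<open>bind\<close> is an iterated integral, and its outer integral
  over a finitely supported pmf is a finite sum. \<open>K\<close> is measurable because the space of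
  a pmf is discrete.\<close>

lemma nn_integral_bind_pmf_pair:
  assumes "finite (set_pmf p)"
    and K: "\<And>x. K x \<in> dists N"
    and R: "R \<in> dists L"
    and g: "g \<in> borel_measurable (N \<Otimes>\<^sub>M L)"
  shows "(\<integral>\<^sup>+ z. g z \<partial>((measure_pmf p \<bind> K) \<Otimes>\<^sub>M R)) =
    (\<Sum>x\<in>set_pmf p. (\<integral>\<^sup>+ z. g z \<partial>(K x \<Otimes>\<^sub>M R)) * ennreal (pmf p x))"
proof -
  interpret R: prob_space R using R by (simp add: space_prob_algebra)
  have sR: "sets R = sets L" using R by (simp add: space_prob_algebra)
  have sK: "sets (K x) = sets N" for x using K by (simp add: space_prob_algebra)
  have gR: "g \<in> borel_measurable (N \<Otimes>\<^sub>M R)"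
    using g by (simp cong: measurable_cong_sets sets_pair_measure_cong add: sR)
  have Ksub: "K x \<in> space (subprob_algebra N)" for x
    using K[of x] by (auto simp: space_prob_algebra space_subprob_algebra prob_space_imp_subprob_space)
  have Km: "K \<in> measure_pmf p \<rightarrow>\<^sub>M subprob_algebra N"
    using Ksub by (simp add: measurable_def)
  have sB: "sets (measure_pmf p \<bind> K) = sets N"
    by (rule sets_bind) (auto simp: sK)
  have fst: "(\<integral>\<^sup>+ z. g z \<partial>(S \<Otimes>\<^sub>M R)) = (\<integral>\<^sup>+ d. \<integral>\<^sup>+ a. g (d, a) \<partial>R \<partial>S)"
    if "sets S = sets N" for S
    using that gR
    by (intro R.nn_integral_fst[symmetric]) (simp cong: measurable_cong_sets sets_pair_measure_cong)
  have "(\<integral>\<^sup>+ z. g z \<partial>((measure_pmf p \<bind> K) \<Otimes>\<^sub>M R)) = (\<integral>\<^sup>+ x. \<integral>\<^sup>+ d. \<integral>\<^sup>+ a. g (d, a) \<partial>R \<partial>K x \<partial>measure_pmf p)"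
    unfolding fst[OF sB]
    by (rule nn_integral_bind[OF R.borel_measurable_nn_integral_fst[OF gR] Km])
  also have "\<dots> = (\<integral>\<^sup>+ x. \<integral>\<^sup>+ z. g z \<partial>(K x \<Otimes>\<^sub>M R) \<partial>measure_pmf p)"
    by (simp add: fst sK)
  finally show ?thesis
    by (simp add: nn_integral_measure_pmf_finite assms(1))
qed

lemma bind_pmf_in_dists:
  assumes "\<And>x. K x \<in> dists N"
  shows "measure_pmf p \<bind> K \<in> dists N"
proof -
  have K_meas: "K \<in> measure_pmf p \<rightarrow>\<^sub>M prob_algebra N"
    using assms by (simp add: measurable_def)
  have p: "measure_pmf p \<in> dists (measure_pmf p)"
    by (simp add: space_prob_algebra measure_pmf.prob_space_axioms)
  show ?thesis
    using prob_space_bind'[OF p K_meas] sets_bind'[OF p K_meas] by (simp add: space_prob_algebra)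
qed

text \<open>The nonnegative version is applied to \<open>f\<close> and to \<open>- f\<close>, that
  is, to the positive and the negative part. Integrability under each \<open>K x\<close> makes both
  sums finite, so their difference is an honest real number.\<close>

lemma integrable_integral_bind_pmf_pair:
  fixes f :: "'b \<times> 'c \<Rightarrow> real"
  assumes fin: "finite (set_pmf p)"
    and K: "\<And>x. K x \<in> dists N"
    and R: "R \<in> dists L"
    and f: "f \<in> borel_measurable (N \<Otimes>\<^sub>M L)"
    and int: "\<And>x. x \<in> set_pmf p \<Longrightarrow> integrable (K x \<Otimes>\<^sub>M R) f"
  shows "integrable ((measure_pmf p \<bind> K) \<Otimes>\<^sub>M R) f" (is ?int)
    and "(\<integral> z. f z \<partial>((measure_pmf p \<bind> K) \<Otimes>\<^sub>M R)) =
      (\<Sum>x\<in>set_pmf p. pmf p x * (\<integral> z. f z \<partial>(K x \<Otimes>\<^sub>M R)))" (is ?eq)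
proof -
  let ?B = "(measure_pmf p \<bind> K) \<Otimes>\<^sub>M R"
  have fB: "f \<in> borel_measurable ?B"
    using f R bind_pmf_in_dists[OF K, of p]
    by (simp add: space_prob_algebra cong: measurable_cong_sets sets_pair_measure_cong)
  have nn: "(\<integral>\<^sup>+ z. ennreal (g z) \<partial>?B) =
      ennreal (\<Sum>x\<in>set_pmf p. enn2real (\<integral>\<^sup>+ z. ennreal (g z) \<partial>(K x \<Otimes>\<^sub>M R)) * pmf p x)"
    if g: "g \<in> borel_measurable (N \<Otimes>\<^sub>M L)"
      and gi: "\<And>x. x \<in> set_pmf p \<Longrightarrow> integrable (K x \<Otimes>\<^sub>M R) g" for g
  proof -
    have "(\<integral>\<^sup>+ z. ennreal (g z) \<partial>?B) =
        (\<Sum>x\<in>set_pmf p. (\<integral>\<^sup>+ z. ennreal (g z) \<partial>(K x \<Otimes>\<^sub>M R)) * ennreal (pmf p x))"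
      using g by (intro nn_integral_bind_pmf_pair[OF fin K R]) auto
    also have "\<dots> = (\<Sum>x\<in>set_pmf p.
        ennreal (enn2real (\<integral>\<^sup>+ z. ennreal (g z) \<partial>(K x \<Otimes>\<^sub>M R)) * pmf p x))"
      using gi by (intro sum.cong) (auto simp: real_integrable_def ennreal_mult' less_top[symmetric])
    finally show ?thesis by (simp add: sum_ennreal)
  qed
  have pos: "(\<integral>\<^sup>+ z. ennreal (f z) \<partial>?B) =
      ennreal (\<Sum>x\<in>set_pmf p. enn2real (\<integral>\<^sup>+ z. ennreal (f z) \<partial>(K x \<Otimes>\<^sub>M R)) * pmf p x)"
    using f int by (rule nn)
  have neg: "(\<integral>\<^sup>+ z. ennreal (- f z) \<partial>?B) =
      ennreal (\<Sum>x\<in>set_pmf p. enn2real (\<integral>\<^sup>+ z. ennreal (- f z) \<partial>(K x \<Otimes>\<^sub>M R)) * pmf p x)"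
    using f int by (intro nn) auto
  show i: ?int
    using fB by (simp add: real_integrable_def pos neg)
  show ?eq
    using int by (simp add: real_lebesgue_integral_def[OF i] pos neg sum_nonneg
        real_lebesgue_integral_def sum_subtractf[symmetric] algebra_simps cong: sum.cong)
qed

lemma nn_integral_return_pair:
  assumes "R \<in> dists L" "d \<in> space N" "g \<in> borel_measurable (N \<Otimes>\<^sub>M L)"
  shows "(\<integral>\<^sup>+ z. g z \<partial>(return N d \<Otimes>\<^sub>M R)) = (\<integral>\<^sup>+ a. g (d, a) \<partial>R)"
proof -
  interpret R: prob_space R using assms(1) by (simp add: space_prob_algebra)
  have sR: "sets R = sets L" using assms(1) by (simp add: space_prob_algebra)
  have gR: "g \<in> borel_measurable (N \<Otimes>\<^sub>M R)"
    using assms(3) by (simp cong: measurable_cong_sets sets_pair_measure_cong add: sR)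
  have "(\<integral>\<^sup>+ z. g z \<partial>(return N d \<Otimes>\<^sub>M R)) = (\<integral>\<^sup>+ d. \<integral>\<^sup>+ a. g (d, a) \<partial>R \<partial>return N d)"
    using gR
    by (intro R.nn_integral_fst[symmetric]) (simp cong: measurable_cong_sets sets_pair_measure_cong)
  then show ?thesis
    by (simp add: nn_integral_return[OF assms(2) R.borel_measurable_nn_integral_fst[OF gR]])
qed

text \<open>The sum stays in \<open>ennreal\<close>, so that a threshold of infinite expectation at
  a single point of the support remains visible in the total.\<close>

lemma expect_pmf_pair:
  assumes fin: "finite (set_pmf p)"
    and R: "prob_space R"
    and meas: "\<And>x. x \<in> set_pmf p \<Longrightarrow> T x \<in> borel_measurable R"
    and nonneg: "\<And>x a. x \<in> set_pmf p \<Longrightarrow> a \<in> space R \<Longrightarrow> 0 \<le> T x a"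
  shows "expect (measure_pmf p \<Otimes>\<^sub>M R) (\<lambda>(x, a). T x a) =
    enn2ereal (\<Sum>x\<in>set_pmf p. (\<integral>\<^sup>+ a. ennreal (T x a) \<partial>R) * ennreal (pmf p x))"
proof -
  interpret R: prob_space R by fact
  interpret pR: pair_prob_space "measure_pmf p" R ..
  text \<open>\<open>T\<close> need not be measurable on the product, but agrees almost everywhere with \<open>g\<close>, which is.\<close>
  define g where "g z = (\<Sum>s\<in>set_pmf p. ennreal (T s (snd z)) * indicator {s} (fst z))" for z
  have supp: "AE z in measure_pmf p \<Otimes>\<^sub>M R. fst z \<in> set_pmf p \<and> snd z \<in> space R"
  proof -
    have "AE z in measure_pmf p \<Otimes>\<^sub>M R. fst z \<in> set_pmf p"
    proof (rule pR.AE_pair_measure)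
      show "{z \<in> space (measure_pmf p \<Otimes>\<^sub>M R). fst z \<in> set_pmf p} \<in> sets (measure_pmf p \<Otimes>\<^sub>M R)"
        by measurable
    qed (simp add: AE_measure_pmf)
    then show ?thesis
      using AE_space by eventually_elim (auto simp: space_pair_measure)
  qed
  have gm: "g \<in> borel_measurable (measure_pmf p \<Otimes>\<^sub>M R)"
    unfolding g_def
  proof (intro borel_measurable_sum borel_measurable_times_ennreal)
    fix s assume s: "s \<in> set_pmf p"
    show "(\<lambda>z. ennreal (T s (snd z))) \<in> borel_measurable (measure_pmf p \<Otimes>\<^sub>M R)"
      using meas[OF s] by measurable
    show "(\<lambda>z. indicator {s} (fst z) :: ennreal) \<in> borel_measurable (measure_pmf p \<Otimes>\<^sub>M R)"
      by (rule measurable_compose[OF measurable_fst]) simp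
  qed
  have gs: "g (x, a) = ennreal (T x a)" if "x \<in> set_pmf p" for x a
    using that fin by (simp add: g_def indicator_def if_distrib sum.delta cong: if_cong)
  have "expect (measure_pmf p \<Otimes>\<^sub>M R) (\<lambda>(x, a). T x a) =
      enn2ereal (\<integral>\<^sup>+ z. ennreal (case z of (x, a) \<Rightarrow> T x a) \<partial>(measure_pmf p \<Otimes>\<^sub>M R))"
    by (rule expect_nonneg, use supp in eventually_elim) (auto simp: nonneg)
  also have "(\<integral>\<^sup>+ z. ennreal (case z of (x, a) \<Rightarrow> T x a) \<partial>(measure_pmf p \<Otimes>\<^sub>M R)) =
      (\<integral>\<^sup>+ z. g z \<partial>(measure_pmf p \<Otimes>\<^sub>M R))"
    by (intro nn_integral_cong_AE, use supp in eventually_elim)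
      (auto simp: gs)
  also have "\<dots> = (\<integral>\<^sup>+ x. \<integral>\<^sup>+ a. g (x, a) \<partial>R \<partial>measure_pmf p)"
    by (rule R.nn_integral_fst[OF gm, symmetric])
  also have "\<dots> = (\<Sum>x\<in>set_pmf p. (\<integral>\<^sup>+ a. g (x, a) \<partial>R) * ennreal (pmf p x))"
    by (simp add: nn_integral_measure_pmf_finite fin)
  also have "\<dots> = (\<Sum>x\<in>set_pmf p. (\<integral>\<^sup>+ a. ennreal (T x a) \<partial>R) * ennreal (pmf p x))"
    by (intro sum.cong refl) (simp add: gs)
  finally show ?thesis .
qed

section \<open>Measurability and integrability of unilateral deviations\<close>

lemma measurable_deviation:
  assumes "i \<in> bidders I"
  shows "(\<lambda>(d, a). a(i := d)) \<in> actions I i \<Otimes>\<^sub>M others I i \<rightarrow>\<^sub>M profiles I"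
proof -
  have "bidders I = insert i (bidders I - {i})" using assms by auto
  then show ?thesis
    unfolding profiles_def others_def split_beta'
    by (intro measurable_fun_upd[where J = "bidders I - {i}"]) (auto intro: measurable_snd measurable_fst)
qed

lemma borel_measurable_deviation:
  assumes "wf_mechanism I M" "i \<in> bidders I"
  shows "(\<lambda>(d, a). payment M (a(i := d)) i) \<in> borel_measurable (actions I i \<Otimes>\<^sub>M others I i)"
    and "(\<lambda>(d, a). utility I M i (a(i := d))) \<in> borel_measurable (actions I i \<Otimes>\<^sub>M others I i)"
proof -
  have pay: "(\<lambda>a. payment M a i) \<in> borel_measurable (profiles I)"
    and alloc: "(\<lambda>a. mech_alloc M a i) \<in> profiles I \<rightarrow>\<^sub>M count_space (allocs I i)"
    using assms by (auto simp: wf_mechanism_def)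
  have "(\<lambda>a. valuation I i (mech_alloc M a i)) \<in> borel_measurable (profiles I)"
    by (rule measurable_compose[OF alloc]) simp
  then have "utility I M i \<in> borel_measurable (profiles I)"
    using pay unfolding utility_def by (rule borel_measurable_diff)
  note ms = measurable_compose[OF measurable_deviation[OF assms(2)] this]
    measurable_compose[OF measurable_deviation[OF assms(2)] pay]
  show "(\<lambda>(d, a). payment M (a(i := d)) i) \<in> borel_measurable (actions I i \<Otimes>\<^sub>M others I i)"
    and "(\<lambda>(d, a). utility I M i (a(i := d))) \<in> borel_measurable (actions I i \<Otimes>\<^sub>M others I i)"
    using ms by (simp_all add: case_prod_unfold)
qed

lemma marginal_others_in_dists:
  assumes "A \<in> dists (profiles I)"
  shows "marginal_others I i A \<in> dists (others I i)"
proof -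
  have "(\<lambda>a. restrict a (bidders I - {i})) \<in> A \<rightarrow>\<^sub>M others I i"
    using assms unfolding space_prob_algebra profiles_def others_def
    by (auto intro: measurable_restrict_subset cong: measurable_cong_sets)
  then show ?thesis
    using assms unfolding marginal_others_def
    by (auto simp: space_prob_algebra intro: prob_space.prob_space_distr)
qed

text \<open>Utility is a valuation minus a payment. The valuation takes finitely many values, so it
  is bounded, and a finite expected payment makes everything integrable. The last bound holds
  because valuations are nonnegative; it is what shows that opting out costs nothing.\<close>

lemma deviation_integrals:
  assumes "wf_instance I" "wf_mechanism I M" "i \<in> bidders I"
    and D: "D \<in> dists (actions I i)" and R: "R \<in> dists (others I i)"
    and fin: "dev_payment M i D R < \<infinity>"
  defines "pay \<equiv> \<lambda>(d, a). payment M (a(i := d)) i"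
    and "val \<equiv> \<lambda>(d, a). utility I M i (a(i := d))"
  shows "integrable (D \<Otimes>\<^sub>M R) pay" "integrable (D \<Otimes>\<^sub>M R) val"
    and "- (\<integral> z. pay z \<partial>(D \<Otimes>\<^sub>M R)) \<le> (\<integral> z. val z \<partial>(D \<Otimes>\<^sub>M R))"
proof -
  have sDR: "sets (D \<Otimes>\<^sub>M R) = sets (actions I i \<Otimes>\<^sub>M others I i)"
    using D R by (intro sets_pair_measure_cong) (auto simp: space_prob_algebra)
  interpret D: prob_space D using D by (simp add: space_prob_algebra)
  interpret R: prob_space R using R by (simp add: space_prob_algebra)
  interpret DR: pair_prob_space D R ..
  have upd: "(\<lambda>(d, a). a(i := d)) \<in> D \<Otimes>\<^sub>M R \<rightarrow>\<^sub>M profiles I"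
    using measurable_deviation[OF assms(3)] measurable_cong_sets[OF sDR refl] by blast
  have prof: "(case z of (d, a) \<Rightarrow> a(i := d)) \<in> space (profiles I)" if "z \<in> space (D \<Otimes>\<^sub>M R)" for z
    using measurable_space[OF upd that] .
  let ?v = "\<lambda>z. valuation I i (mech_alloc M (case z of (d, a) \<Rightarrow> a(i := d)) i)"
  have pay_eq: "pay = (\<lambda>z. payment M (case z of (d, a) \<Rightarrow> a(i := d)) i)"
    by (auto simp: pay_def)
  have val_eq: "val = (\<lambda>z. ?v z - pay z)"
    by (auto simp: val_def pay_def utility_def)
  have pay0: "AE z in D \<Otimes>\<^sub>M R. 0 \<le> pay z"
    using AE_space by eventually_elim (use prof assms(2,3) in \<open>auto simp: wf_mechanism_def pay_eq\<close>)
  have "pay \<in> borel_measurable (D \<Otimes>\<^sub>M R)"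
    unfolding pay_eq using assms(2,3) by (intro measurable_compose[OF upd]) (auto simp: wf_mechanism_def)
  then show ip: "integrable (D \<Otimes>\<^sub>M R) pay"
    using pay0 fin unfolding dev_payment_def pay_def by (rule integrable_of_expect)
  have alloc: "(\<lambda>z. mech_alloc M (case z of (d, a) \<Rightarrow> a(i := d)) i) \<in> D \<Otimes>\<^sub>M R \<rightarrow>\<^sub>M count_space (allocs I i)"
    using assms(2,3) by (intro measurable_compose[OF upd]) (auto simp: wf_mechanism_def)
  have vm: "?v \<in> borel_measurable (D \<Otimes>\<^sub>M R)"
    by (rule measurable_compose[OF alloc]) simp
  have va: "mech_alloc M (case z of (d, a) \<Rightarrow> a(i := d)) i \<in> allocs I i" if "z \<in> space (D \<Otimes>\<^sub>M R)" for z
    using measurable_space[OF alloc that] by simp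
  have fa: "finite (allocs I i)" and v0: "\<And>x. x \<in> allocs I i \<Longrightarrow> 0 \<le> valuation I i x"
    using assms(1,3) by (auto simp: wf_instance_def)
  have iv: "integrable (D \<Otimes>\<^sub>M R) ?v"
  proof (rule DR.integrable_const_bound[OF _ vm])
    \<comment> \<open>The sum of all valuations is a convenient constant bound: each summand is
      nonnegative, so the sum dominates every single one.\<close>
    show "AE z in D \<Otimes>\<^sub>M R. norm (?v z) \<le> (\<Sum>x\<in>allocs I i. valuation I i x)"
      using AE_space
    proof eventually_elim
      case (elim z)
      show ?case
        using va[OF elim] fa v0 by (auto intro: member_le_sum)
    qed
  qed
  show "integrable (D \<Otimes>\<^sub>M R) val"
    unfolding val_eq using iv ip by (rule Bochner_Integration.integrable_diff)
  have "0 \<le> (\<integral> z. ?v z \<partial>(D \<Otimes>\<^sub>M R))"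
    using va v0 by (intro Bochner_Integration.integral_nonneg) auto
  then show "- (\<integral> z. pay z \<partial>(D \<Otimes>\<^sub>M R)) \<le> (\<integral> z. val z \<partial>(D \<Otimes>\<^sub>M R))"
    unfolding val_eq using iv ip by simp
qed

section \<open>Mixing deviations and opting out\<close>

text \<open>Linearity of expectation in the initial draw. It is applied twice below: to the draw of
  an allocation from the optimal marginal, and to the coin that decides between deviating and opting
  out.\<close>

lemma mixed_deviation:
  assumes "wf_instance I" "wf_mechanism I M" "i \<in> bidders I"
    and fin: "finite (set_pmf p)"
    and K: "\<And>x. K x \<in> dists (actions I i)" and R: "R \<in> dists (others I i)"
    and finite_pay: "\<And>x. x \<in> set_pmf p \<Longrightarrow> dev_payment M i (K x) R < \<infinity>"
  shows "dev_payment M i (measure_pmf p \<bind> K) R =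
      ereal (\<Sum>x\<in>set_pmf p. pmf p x * real_of_ereal (dev_payment M i (K x) R))" (is ?pay)
    and "dev_utility I M i (measure_pmf p \<bind> K) R =
      ereal (\<Sum>x\<in>set_pmf p. pmf p x * real_of_ereal (dev_utility I M i (K x) R))" (is ?ut)
proof -
  note int = deviation_integrals[OF assms(1-3) K R finite_pay]
  note mp = integrable_integral_bind_pmf_pair[OF fin K R borel_measurable_deviation(1)[OF assms(2,3)] int(1)]
  note mu = integrable_integral_bind_pmf_pair[OF fin K R borel_measurable_deviation(2)[OF assms(2,3)] int(2)]
  show ?pay ?ut
    unfolding dev_payment_def dev_utility_def
    by (simp_all add: expect_eq_integral[OF mp(1)] mp(2) expect_eq_integral[OF mu(1)] mu(2)
        expect_eq_integral[OF int(1)] expect_eq_integral[OF int(2)] cong: sum.cong)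
qed

lemma opt_out_deviation:
  assumes "wf_instance I" "wf_mechanism I M" "i \<in> bidders I"
    and R: "R \<in> dists (others I i)"
  obtains D where "D \<in> dists (actions I i)" "dev_payment M i D R = 0" "0 \<le> dev_utility I M i D R"
proof -
  obtain d where d: "d \<in> space (actions I i)"
    and d0: "\<And>a. a \<in> space (others I i) \<Longrightarrow> payment M (a(i := d)) i = 0"
    using assms(2,3) by (auto simp: wf_mechanism_def)
  let ?D = "return (actions I i) d" and ?pay = "\<lambda>(d, a). payment M (a(i := d)) i"
  have D: "?D \<in> dists (actions I i)"
    using d by (simp add: space_prob_algebra prob_space_return)
  have spR: "space R = space (others I i)"
    using R by (intro sets_eq_imp_space_eq) (simp add: space_prob_algebra)
  have "?pay \<in> borel_measurable (actions I i \<Otimes>\<^sub>M others I i)"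
    using assms(2,3) by (rule borel_measurable_deviation)
  \<comment> \<open>The factor \<open>c\<close> treats both halves of \<open>expect\<close> at once:
    \<open>c = 1\<close> gives the positive part and \<open>c = -1\<close> the negative
    part.\<close>
  then have "(\<integral>\<^sup>+ z. ennreal (c * ?pay z) \<partial>(?D \<Otimes>\<^sub>M R)) = 0" for c :: real
    by (subst nn_integral_return_pair[OF R d]) (auto simp: d0 spR cong: nn_integral_cong_simp)
  from this[of 1] this[of "-1"] have p0: "dev_payment M i ?D R = 0"
    by (simp add: dev_payment_def expect_def zero_ennreal.rep_eq)
  have "dev_payment M i ?D R < \<infinity>" by (simp add: p0)
  note int = deviation_integrals[OF assms(1-3) D R this]
  have "0 \<le> dev_utility I M i ?D R"
    using int(3) p0 unfolding dev_utility_def dev_payment_def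
    by (simp add: expect_eq_integral[OF int(1)] expect_eq_integral[OF int(2)])
  with D p0 that show ?thesis by blast
qed

section \<open>From conservative to budget-feasible deviations\<close>

theorem theorem3p2:
  fixes I :: "('a, 'x) auction_instance"
    and M :: "('a, 'x) mechanism"
    and E :: "(nat \<Rightarrow> 'a) measure set"
    and i :: nat
    and T :: "'x \<Rightarrow> (nat \<Rightarrow> 'a) \<Rightarrow> real"
    and Q :: "(nat \<Rightarrow> 'x) pmf"
    and lam mu :: real
  assumes "wf_instance I"
    and "wf_mechanism I M"
    and "E \<subseteq> CCE I M"
    and "i \<in> bidders I"
    and "threshold_function I i T"
    and "optimal_liquid_profile I Q"
    and "lam > 0"
    and "mu \<ge> 0"
    and "conservatively_semi_smooth I M E i T lam mu"
  shows "budget_feasible_semi_smooth I M E i T Q lam mu"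
  unfolding budget_feasible_semi_smooth_def
proof
  fix A assume A: "A \<in> E"
  define R where "R = marginal_others I i A"
  have R: "R \<in> dists (others I i)"
    using A assms(3) unfolding R_def CCE_def by (intro marginal_others_in_dists) auto
  then have prob: "prob_space R" and sR: "sets R = sets (others I i)"
    by (auto simp: space_prob_algebra)
  have spR: "space R = space (others I i)"
    using sR by (rule sets_eq_imp_space_eq)
  \<comment> \<open>The opt-out deviation \<open>Z\<close> has three uses: it makes the family
    \<open>K\<close> total, it is the answer when the threshold term is infinite, and it is the
    other side of the coin when the budget binds.\<close>
  obtain Z where Z: "Z \<in> dists (actions I i)" "dev_payment M i Z R = 0" "0 \<le> dev_utility I M i Z R"
    using opt_out_deviation[OF assms(1,2,4) R] .
  define p where "p = alloc_marginal i Q"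
  define S where "S = set_pmf p"
  let ?v = "valuation I i"
  have fa: "finite (allocs I i)" and v0: "\<And>x. x \<in> allocs I i \<Longrightarrow> 0 \<le> ?v x"
    and B0: "0 < budget I i"
    using assms(1,4) by (auto simp: wf_instance_def)
  \<comment> \<open>Feasibility of \<open>Q\<close> confines the support of its marginal to the
    finite set \<open>allocs I i\<close>, so all averages over the marginal are finite sums.\<close>
  have Sa: "S \<subseteq> allocs I i"
    using assms(1,4,6)
    by (auto simp: S_def p_def alloc_marginal_def optimal_liquid_profile_def alloc_dists_def wf_instance_def)
  then have fS: "finite S" using fa finite_subset by blast
  define V where "V = (\<Sum>x\<in>S. pmf p x * ?v x)"
  have V0: "0 \<le> V" unfolding V_def using Sa v0 by (intro sum_nonneg) auto
  have EV: "expect (measure_pmf p) ?v = ereal V"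
    using fS
    by (simp add: expect_eq_integral integrable_measure_pmf_finite S_def V_def
        integral_measure_pmf_real[of "set_pmf p"] mult.commute)
  obtain K' where K': "\<And>x. x \<in> allocs I i \<Longrightarrow> K' x \<in> dists (actions I i)"
    "\<And>x. x \<in> allocs I i \<Longrightarrow> dev_utility I M i (K' x) R \<ge> ereal lam * ereal (?v x) - ereal mu * expect R (T x)"
    "\<And>x. x \<in> allocs I i \<Longrightarrow> dev_payment M i (K' x) R \<le> ereal (?v x)"
    using assms(9) A unfolding conservatively_semi_smooth_def R_def by metis
  \<comment> \<open>\<open>bind_pmf_in_dists\<close> and \<open>mixed_deviation\<close> want a
    distribution at every point of the type, so \<open>K'\<close> is padded with \<open>Z\<close>
    outside the allocation set.\<close>
  define K where "K x = (if x \<in> allocs I i then K' x else Z)" for x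
  have Kd: "K x \<in> dists (actions I i)" for x
    using K'(1) Z(1) by (simp add: K_def)
  have Kp: "dev_payment M i (K x) R \<le> ereal (?v x)"
    and Ku: "dev_utility I M i (K x) R \<ge> ereal lam * ereal (?v x) - ereal mu * expect R (T x)"
    if "x \<in> S" for x
    using that Sa K'(2,3) by (auto simp: K_def)
  \<comment> \<open>The conservative payment bound is a real number, so payments are integrable even
    when the budget is infinite.\<close>
  have Kfin: "dev_payment M i (K x) R < \<infinity>" if "x \<in> set_pmf p" for x
    using Kp[of x] that by (auto simp: S_def intro: le_less_trans)
  note int = deviation_integrals[OF assms(1,2,4) Kd R Kfin]
  define pay where "pay x = real_of_ereal (dev_payment M i (K x) R)" for x
  define ut where "ut x = real_of_ereal (dev_utility I M i (K x) R)" for x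
  have pay: "dev_payment M i (K x) R = ereal (pay x)" and ut: "dev_utility I M i (K x) R = ereal (ut x)"
    if "x \<in> S" for x
    using int(1,2)[of x] that
    by (simp_all add: S_def pay_def ut_def dev_payment_def dev_utility_def expect_eq_integral)
  define D where "D = measure_pmf p \<bind> K"
  have D: "D \<in> dists (actions I i)"
    unfolding D_def using Kd by (rule bind_pmf_in_dists)
  have Dpay: "dev_payment M i D R = ereal (\<Sum>x\<in>S. pmf p x * pay x)"
    and Dut: "dev_utility I M i D R = ereal (\<Sum>x\<in>S. pmf p x * ut x)"
    using mixed_deviation[OF assms(1,2,4) fS[unfolded S_def] Kd R Kfin]
    by (auto simp: D_def S_def pay_def ut_def)
  have payV: "(\<Sum>x\<in>S. pmf p x * pay x) \<le> V"
    unfolding V_def using Kp pay by (intro sum_mono mult_left_mono) auto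
  define t where "t x = (\<integral>\<^sup>+ a. ennreal (T x a) \<partial>R)" for x
  have Tm: "T x \<in> borel_measurable R" and T0: "\<And>a. a \<in> space R \<Longrightarrow> 0 \<le> T x a" if "x \<in> S" for x
    using that Sa assms(5) sR spR by (auto simp: threshold_function_def cong: measurable_cong_sets)
  have ET: "expect (measure_pmf p \<Otimes>\<^sub>M R) (\<lambda>(x, a). T x a) = enn2ereal (\<Sum>x\<in>S. t x * ennreal (pmf p x))"
    unfolding t_def S_def using Tm T0 fS prob by (intro expect_pmf_pair) (auto simp: S_def)
  have Et: "expect R (T x) = enn2ereal (t x)" if "x \<in> S" for x
    unfolding t_def using T0[OF that] by (intro expect_nonneg AE_I2) auto
  have "\<exists>D\<in>feasible_devs I M i R. dev_utility I M i D R \<ge>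
     ereal lam * liquid_value I i p - ereal mu * expect (measure_pmf p \<Otimes>\<^sub>M R) (\<lambda>(x, a). T x a)"
  \<comment> \<open>The split separates the situation in which the subtracted term is infinite; for
    \<open>mu = 0\<close> it vanishes whatever the thresholds are.\<close>
  proof (cases "mu = 0 \<or> (\<forall>x\<in>S. t x \<noteq> \<infinity>)")
    case False
    then obtain x where x: "x \<in> S" "t x = \<infinity>" and mu: "mu > 0" using assms(8) by auto
    \<comment> \<open>A point of the support has positive mass, so an infinite threshold there makes
      the whole average infinite.\<close>
    have "t x * ennreal (pmf p x) = top"
      using x by (auto simp: ennreal_mult_eq_top_iff S_def set_pmf_iff)
    then have "(\<Sum>x\<in>S. t x * ennreal (pmf p x)) = top"
      using x(1) fS by (metis ennreal_sum_eq_top)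
    then have inf: "expect (measure_pmf p \<Otimes>\<^sub>M R) (\<lambda>(x, a). T x a) = \<infinity>"
      unfolding ET by (simp add: top_ennreal.rep_eq top_ereal_def)
    \<comment> \<open>Finiteness matters, since \<open>\<infinity> - \<infinity>\<close> is
      \<open>\<infinity>\<close> in \<open>ereal\<close>. The value is at most the real
      \<open>V\<close>, and it is not \<open>-\<infinity>\<close> because the budget is positive.
      The guarantee is then \<open>-\<infinity>\<close>, which opting out meets trivially.\<close>
    have "liquid_value I i p \<noteq> \<infinity>" "liquid_value I i p \<noteq> - \<infinity>"
      using B0 by (auto simp: liquid_value_def EV min_def)
    then have "ereal lam * liquid_value I i p
        - ereal mu * expect (measure_pmf p \<Otimes>\<^sub>M R) (\<lambda>(x, a). T x a) = - \<infinity>"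
      using mu by (cases "liquid_value I i p") (auto simp: inf)
    then show ?thesis
      using Z B0 by (intro bexI[of _ Z]) (auto simp: feasible_devs_def)
  next
    case True
    \<comment> \<open>\<open>enn2real\<close> sends an infinite threshold to 0. This is harmless: in
      the present case it can happen only for \<open>mu = 0\<close>, where \<open>W\<close> is
      multiplied by 0 and the extended-real term is 0 as well.\<close>
    define W where "W = (\<Sum>x\<in>S. pmf p x * enn2real (t x))"
    have W0: "0 \<le> W" by (auto simp: W_def intro: sum_nonneg)
    have fin_t: "enn2ereal (t x) = ereal (enn2real (t x))" if "x \<in> S" "mu \<noteq> 0" for x
      using that True by (cases "t x") (auto simp: top_ennreal.rep_eq)
    have muW: "ereal mu * expect (measure_pmf p \<Otimes>\<^sub>M R) (\<lambda>(x, a). T x a) = ereal (mu * W)"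
    proof (cases "mu = 0")
      case False
      have "(\<Sum>x\<in>S. t x * ennreal (pmf p x)) = (\<Sum>x\<in>S. ennreal (pmf p x * enn2real (t x)))"
        using False True by (intro sum.cong) (auto simp: ennreal_mult' mult.commute less_top[symmetric])
      also have "\<dots> = ennreal W" by (simp add: W_def)
      finally show ?thesis using W0 by (simp add: ET)
    qed (simp add: zero_ereal_def[symmetric])
    have ut_ge: "lam * ?v x - mu * enn2real (t x) \<le> ut x" if "x \<in> S" for x
      using Ku[OF that] ut[OF that] Et[OF that] fin_t[OF that]
      by (cases "mu = 0") (auto simp: zero_ereal_def[symmetric])
    have "lam * V - mu * W = (\<Sum>x\<in>S. pmf p x * (lam * ?v x - mu * enn2real (t x)))"
      by (simp add: V_def W_def sum_distrib_left sum_subtractf algebra_simps)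
    also have "\<dots> \<le> (\<Sum>x\<in>S. pmf p x * ut x)"
      using ut_ge by (intro sum_mono mult_left_mono) auto
    finally have utV: "lam * V - mu * W \<le> (\<Sum>x\<in>S. pmf p x * ut x)" .
    show ?thesis
    proof (cases "ereal V \<le> budget I i")
      \<comment> \<open>The average payment is at most \<open>V\<close>, hence within the budget,
        and the liquid value is \<open>V\<close> itself: \<open>D\<close> works unscaled.\<close>
      case True
      then have "D \<in> feasible_devs I M i R"
        using D payV order_trans[of "ereal (\<Sum>x\<in>S. pmf p x * pay x)" "ereal V"]
        by (simp add: feasible_devs_def Dpay)
      moreover have "liquid_value I i p = ereal V"
        using True by (simp add: liquid_value_def EV min_def)
      ultimately show ?thesis
        using utV by (intro bexI[of _ D]) (auto simp: Dut muW)
    next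
      case False
      then obtain B where B: "budget I i = ereal B" "0 < B" "B < V"
        using B0 by (cases "budget I i") auto
      \<comment> \<open>The probability of playing \<open>D\<close> is chosen so that
        \<open>q * V = B\<close>: the payment bound \<open>V\<close> shrinks to exactly the budget,
        and \<open>lam * V\<close> shrinks to \<open>lam\<close> times the capped value.
        \<open>V\<close> is positive since it exceeds \<open>B\<close>.\<close>
      define q where "q = B / V"
      have q: "0 < q" "q < 1" "q * V = B"
        using B by (auto simp: q_def)
      define D' where "D' = measure_pmf (bernoulli_pmf q) \<bind> (\<lambda>b. if b then D else Z)"
      have dists: "(if b then D else Z) \<in> dists (actions I i)" for b
        using D Z(1) by simp
      have D': "D' \<in> dists (actions I i)"
        unfolding D'_def using dists by (rule bind_pmf_in_dists)
      have "dev_payment M i (if b then D else Z) R < \<infinity>" for b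
        by (simp add: Dpay Z(2))
      note mix = mixed_deviation[OF assms(1,2,4) _ dists R this, of "bernoulli_pmf q"]
      have D'pay: "dev_payment M i D' R = ereal (q * (\<Sum>x\<in>S. pmf p x * pay x))"
        and D'ut: "dev_utility I M i D' R =
          ereal (q * (\<Sum>x\<in>S. pmf p x * ut x) + (1 - q) * real_of_ereal (dev_utility I M i Z R))"
        using q mix unfolding D'_def
        by (simp_all add: set_pmf_bernoulli UNIV_bool Dpay Dut Z(2))
      have "q * (\<Sum>x\<in>S. pmf p x * pay x) \<le> q * V"
        using payV q(1) by simp
      then have "D' \<in> feasible_devs I M i R"
        using D' q by (simp add: feasible_devs_def D'pay B)
      moreover have "liquid_value I i p = ereal B"
        using B by (simp add: liquid_value_def EV min_def)
      moreover have "lam * B - mu * W \<le>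
          q * (\<Sum>x\<in>S. pmf p x * ut x) + (1 - q) * real_of_ereal (dev_utility I M i Z R)"
      proof -
        have "q * (mu * W) \<le> mu * W"
          using q W0 assms(8) by (intro mult_left_le_one_le) auto
        then have "lam * B - mu * W \<le> q * (lam * V - mu * W)"
          by (simp add: q(3)[symmetric] algebra_simps)
        also have "\<dots> \<le> q * (\<Sum>x\<in>S. pmf p x * ut x)"
          using utV q(1) by simp
        finally show ?thesis
          using q Z(3) by (simp add: real_of_ereal_pos add_increasing2)
      qed
      ultimately show ?thesis
        by (intro bexI[of _ D']) (auto simp: D'ut muW)
    qed
  qed
  then show "\<exists>D\<in>feasible_devs I M i (marginal_others I i A).
      dev_utility I M i D (marginal_others I i A)
        \<ge> ereal lam * liquid_value I i (alloc_marginal i Q)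
          - ereal mu * expect (measure_pmf (alloc_marginal i Q) \<Otimes>\<^sub>M marginal_others I i A) (\<lambda>(x, a). T x a)"
    by (simp add: R_def p_def)
qed

end
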